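(* Let $G$ be the group of transformations of $\mathbb{Z}^3$ generated by $$\sigma_1:(k,l,m)\mapsto(m-k,l,m),\quad \sigma_2:(k,l,m)\mapsto(k,l,k+l-m),\quad \sigma_3:(k,l,m)\mapsto(l,k,m),$$ $$\sigma_4:(k,l,m)\mapsto(m-k,m-l,m),\quad \sigma_5:(k,l,m)\mapsto(-k,-l,-m).$$ Then the set $$\{(k,l,m)\in\mathbb{Z}^3\mid 0\le k+l-m\le l-k\le m\}$$ is a complete system of representatives of the quotient $G\backslash\mathbb{Z}^3$.
   Context: A complete system of representatives of $G\backslash\mathbb{Z}^3$ is a subset of $\mathbb{Z}^3$ containing exactly one element of each $G$-orbit. *)

theory Defs
  imports "HOL-Algebra.Generated_Groups" "HOL-Algebra.Group_Action"
begin

type_synonym int3 = "int \<times> int \<times> int"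

definition sigma1 :: "int3 \<Rightarrow> int3" where
  "sigma1 = (\<lambda>(k, l, m). (m - k, l, m))"

definition sigma2 :: "int3 \<Rightarrow> int3" where
  "sigma2 = (\<lambda>(k, l, m). (k, l, k + l - m))"

definition sigma3 :: "int3 \<Rightarrow> int3" where
  "sigma3 = (\<lambda>(k, l, m). (l, k, m))"

definition sigma4 :: "int3 \<Rightarrow> int3" where
  "sigma4 = (\<lambda>(k, l, m). (m - k, m - l, m))"

definition sigma5 :: "int3 \<Rightarrow> int3" where
  "sigma5 = (\<lambda>(k, l, m). (- k, - l, - m))"

definition sigmas :: "(int3 \<Rightarrow> int3) set" where
  "sigmas = {sigma1, sigma2, sigma3, sigma4, sigma5}"

definition G :: "(int3 \<Rightarrow> int3) monoid" where
  "G = (BijGroup UNIV) \<lparr>carrier := generate (BijGroup UNIV) sigmas\<rparr>"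

definition complete_representatives ::
    "('g, 'c) monoid_scheme \<Rightarrow> 'b set \<Rightarrow> ('g \<Rightarrow> 'b \<Rightarrow> 'b) \<Rightarrow> 'b set \<Rightarrow> bool" where
  "complete_representatives H E \<phi> R \<longleftrightarrow>
     R \<subseteq> E \<and> (\<forall>X \<in> orbits H E \<phi>. \<exists>!x. x \<in> R \<inter> X)"

text \<open>Multiplication and inversion in \<open>BijGroup\<close> are only meaningful on its carrier,
  so the generators have to lie in it.\<close>

lemma sigmas_Bij: "sigmas \<subseteq> carrier (BijGroup UNIV)"
proof -
  have "f \<in> Bij UNIV" if "\<And>x. f (f x) = x" for f :: "int3 \<Rightarrow> int3"
    using that involuntory_imp_bij[of f] by (simp add: Bij_def)
  then show ?thesis
    by (auto simp: BijGroup_def sigmas_def sigma1_def sigma2_def sigma3_def sigma4_def sigma5_def)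
qed

lemma subgroup_sigmas: "subgroup (generate (BijGroup UNIV) sigmas) (BijGroup UNIV)"
  by (rule group.generate_is_subgroup[OF group_BijGroup sigmas_Bij])

lemma group_action_G: "group_action G UNIV id"
proof -
  have "subgroup (carrier G) (BijGroup UNIV)"
    using subgroup_sigmas by (simp add: G_def)
  then have "group G"
    using group.subgroup_imp_group[OF group_BijGroup] subgroup_sigmas by (simp add: G_def)
  moreover have "id \<in> hom G (BijGroup UNIV)"
    using subgroup.subset[OF subgroup_sigmas] by (auto simp: hom_def G_def)
  ultimately show ?thesis
    by (simp add: group_action_def group_hom_def group_hom_axioms_def group_BijGroup)
qed

end

theory Submission
  imports Defs "HOL-Library.Multiset"
begin

text \<open>
  In the coordinates \<open>p = k + l - m\<close>, \<open>q = l - k\<close> and \<open>m\<close> itself, the group \<open>G\<close> becomes the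
  group of signed permutations of three coordinates: \<open>\<sigma>\<^sub>1\<close> swaps \<open>p\<close> and \<open>q\<close>, \<open>\<sigma>\<^sub>2\<close> swaps \<open>p\<close> and \<open>m\<close>,
  \<open>\<sigma>\<^sub>3\<close> negates \<open>q\<close>, \<open>\<sigma>\<^sub>4\<close> negates \<open>p\<close> and \<open>q\<close>, and \<open>\<sigma>\<^sub>5\<close> negates everything.
  The change of coordinates embeds \<open>\<int>\<^sup>3\<close> as the sublattice \<open>p + q + m\<close> even, which signed
  permutations preserve. The set in question is \<open>0 \<le> p \<le> q \<le> m\<close>.

  An orbit therefore meets the set at most once, since the multiset of absolute values
  is constant on orbits (\<open>abs_pqm_orbit\<close>) and a sorted nonnegative triple can be read off
  from it (\<open>sorted_abs_triple_eq\<close>). It meets the set at least once, since negating and swapping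
  coordinates makes any triple nonnegative and then sorts it (\<open>signed_permutation_sort\<close>).
\<close>

lemma orbit_G: "orbit G id x = {g x | g. g \<in> generate (BijGroup UNIV) sigmas}"
  by (simp add: orbit_def G_def)

lemma orbit_G_refl: "x \<in> orbit G id x"
proof -
  have "x = \<one>\<^bsub>BijGroup UNIV\<^esub> x"
    by (simp add: BijGroup_def)
  then show ?thesis
    unfolding orbit_G using generate.one[of "BijGroup UNIV" sigmas] by blast
qed

lemma generate_sigmas_Bij: "g \<in> generate (BijGroup UNIV) sigmas \<Longrightarrow> g \<in> Bij UNIV"
  using subgroup.subset[OF subgroup_sigmas] by (auto simp: BijGroup_def)

lemma mult_BijGroup_apply:
  "g \<in> Bij UNIV \<Longrightarrow> h \<in> Bij UNIV \<Longrightarrow> (g \<otimes>\<^bsub>BijGroup UNIV\<^esub> h) x = g (h x)"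
  by (simp add: BijGroup_def compose_def)

lemma orbit_G_closed:
  assumes s: "s \<in> sigmas" and y: "y \<in> orbit G id x"
  shows "s y \<in> orbit G id x"
proof -
  from y obtain g where g: "g \<in> generate (BijGroup UNIV) sigmas" "y = g x"
    by (auto simp: orbit_G)
  have "s \<otimes>\<^bsub>BijGroup UNIV\<^esub> g \<in> generate (BijGroup UNIV) sigmas"
    using generate.eng[OF generate.incl[OF s] g(1)] .
  moreover have "s y = (s \<otimes>\<^bsub>BijGroup UNIV\<^esub> g) x"
    using g(2) mult_BijGroup_apply[OF generate_sigmas_Bij[OF generate.incl[OF s]]
        generate_sigmas_Bij[OF g(1)]] by simp
  ultimately show ?thesis
    unfolding orbit_G by blast
qed

lemma generate_sigmas_invariant:
  assumes sigmas: "\<And>s x. s \<in> sigmas \<Longrightarrow> f (s x) = f x"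
    and g: "g \<in> generate (BijGroup UNIV) sigmas"
  shows "f (g x) = f x"
  using g
proof (induction arbitrary: x rule: generate.induct)
  case one
  then show ?case by (simp add: BijGroup_def)
next
  case (incl h)
  then show ?case by (rule sigmas)
next
  case (inv h)
  have h: "h \<in> Bij UNIV"
    using generate_sigmas_Bij generate.incl[OF inv] by blast
  then have "h ((inv\<^bsub>BijGroup UNIV\<^esub> h) x) = x"
    by (simp add: inv_BijGroup Bij_def bij_betw_def surj_f_inv_f)
  then show ?case
    using sigmas[OF inv] by metis
next
  case (eng g h)
  then show ?case
    by (simp add: mult_BijGroup_apply generate_sigmas_Bij)
qed

definition abs_pqm :: "int3 \<Rightarrow> int multiset" where
  "abs_pqm = (\<lambda>(k, l, m). {#\<bar>k + l - m\<bar>, \<bar>l - k\<bar>, \<bar>m\<bar>#})"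

lemma abs_pqm_sigmas:
  assumes "s \<in> sigmas"
  shows "abs_pqm (s x) = abs_pqm x"
proof -
  obtain k l m where x: "x = (k, l, m)"
    by (cases x)
  have abs_eqs: "\<bar>m - k + l - m\<bar> = \<bar>l - k\<bar>" "\<bar>l - (m - k)\<bar> = \<bar>k + l - m\<bar>"
    "\<bar>k + l - (k + l - m)\<bar> = \<bar>m\<bar>" "\<bar>l + k - m\<bar> = \<bar>k + l - m\<bar>" "\<bar>k - l\<bar> = \<bar>l - k\<bar>"
    "\<bar>m - k + (m - l) - m\<bar> = \<bar>k + l - m\<bar>" "\<bar>m - l - (m - k)\<bar> = \<bar>l - k\<bar>"
    "\<bar>- k + - l - - m\<bar> = \<bar>k + l - m\<bar>" "\<bar>- l - - k\<bar> = \<bar>l - k\<bar>"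
    by linarith+
  have "abs_pqm (sigma1 x) = abs_pqm x" "abs_pqm (sigma2 x) = abs_pqm x"
    "abs_pqm (sigma3 x) = abs_pqm x" "abs_pqm (sigma4 x) = abs_pqm x"
    "abs_pqm (sigma5 x) = abs_pqm x"
    unfolding x abs_pqm_def sigma1_def sigma2_def sigma3_def sigma4_def sigma5_def
      prod.case abs_eqs abs_minus_cancel
    by (simp_all only: add_mset_commute)
  then show ?thesis
    using assms by (auto simp: sigmas_def)
qed

lemma abs_pqm_orbit: "y \<in> orbit G id x \<Longrightarrow> abs_pqm y = abs_pqm x"
  using generate_sigmas_invariant[where f = abs_pqm] abs_pqm_sigmas unfolding orbit_G by blast

lemma sorted_abs_triple_eq:
  fixes a b c a' b' c' :: int
  assumes "{#\<bar>a\<bar>, \<bar>b\<bar>, \<bar>c\<bar>#} = {#\<bar>a'\<bar>, \<bar>b'\<bar>, \<bar>c'\<bar>#}"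
    and "0 \<le> a" "a \<le> b" "b \<le> c" "0 \<le> a'" "a' \<le> b'" "b' \<le> c'"
  shows "a = a'" "b = b'" "c = c'"
proof -
  have "mset [a, b, c] = mset [a', b', c']" "sorted [a, b, c]" "sorted [a', b', c']"
    using assms by simp_all
  then have "[a, b, c] = [a', b', c']"
    by (metis properties_for_sort)
  then show "a = a'" "b = b'" "c = c'"
    by simp_all
qed

text \<open>The two transpositions generate all permutations of the coordinates, and conjugating
  the negation of the middle coordinate by them gives the other two negations.\<close>

lemma signed_permutation_sort:
  fixes a b c :: "'a::linordered_idom"
  assumes swap12: "\<And>a b c. P a b c \<Longrightarrow> P b a c"
    and swap13: "\<And>a b c. P a b c \<Longrightarrow> P c b a"
    and neg2: "\<And>a b c. P a b c \<Longrightarrow> P a (- b) c"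
    and P: "P a b c"
  obtains a' b' c' where "P a' b' c'" "0 \<le> a'" "a' \<le> b'" "b' \<le> c'"
proof -
  have abs2: "P x \<bar>y\<bar> z" if "P x y z" for x y z
    using that neg2[OF that] by (simp add: abs_if)
  have swap23: "P x z y" if "P x y z" for x y z
    using swap12[OF swap13[OF swap12[OF that]]] .
  have "P \<bar>a\<bar> \<bar>b\<bar> \<bar>c\<bar>"
    using swap12[OF abs2[OF swap12[OF swap23[OF abs2[OF swap23[OF abs2[OF P]]]]]]] .
  moreover have "0 \<le> \<bar>a\<bar>" "0 \<le> \<bar>b\<bar>" "0 \<le> \<bar>c\<bar>"
    by simp_all
  ultimately show thesis
    by (cases rule: le_cases3[of "\<bar>a\<bar>" "\<bar>b\<bar>" "\<bar>c\<bar>"]) (blast intro: that swap12 swap13 swap23)+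
qed

lemma orbit_G_meets:
  obtains k l m where "(k, l, m) \<in> orbit G id x"
    "0 \<le> k + l - m" "k + l - m \<le> l - k" "l - k \<le> m"
proof -
  define P where "P = (\<lambda>p q m. \<exists>k l. (k, l, m) \<in> orbit G id x \<and> p = k + l - m \<and> q = l - k)"
  have swap12: "P q p m" if pqm: "P p q m" for p q m
  proof -
    obtain k l where "(k, l, m) \<in> orbit G id x" "p = k + l - m" "q = l - k"
      using pqm by (auto simp: P_def)
    then show ?thesis
      using orbit_G_closed[of sigma1 "(k, l, m)" x] unfolding P_def
      by (intro exI[of _ "m - k"] exI[of _ l]) (simp add: sigmas_def sigma1_def)
  qed
  have swap13: "P m q p" if pqm: "P p q m" for p q m
  proof -
    obtain k l where "(k, l, m) \<in> orbit G id x" "p = k + l - m" "q = l - k"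
      using pqm by (auto simp: P_def)
    then show ?thesis
      using orbit_G_closed[of sigma2 "(k, l, m)" x] unfolding P_def
      by (intro exI[of _ k] exI[of _ l]) (simp add: sigmas_def sigma2_def)
  qed
  have neg2: "P p (- q) m" if pqm: "P p q m" for p q m
  proof -
    obtain k l where "(k, l, m) \<in> orbit G id x" "p = k + l - m" "q = l - k"
      using pqm by (auto simp: P_def)
    then show ?thesis
      using orbit_G_closed[of sigma3 "(k, l, m)" x] unfolding P_def
      by (intro exI[of _ l] exI[of _ k]) (simp add: sigmas_def sigma3_def)
  qed
  obtain k l m where "x = (k, l, m)"
    by (cases x)
  then have "P (k + l - m) (l - k) m"
    using orbit_G_refl[of x] by (auto simp: P_def)
  then obtain p q n where "P p q n" "0 \<le> p" "p \<le> q" "q \<le> n"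
    using signed_permutation_sort[of P] swap12 swap13 neg2 by metis
  then show thesis
    using that by (auto simp: P_def)
qed

theorem mainTheorem3:
  shows "complete_representatives G UNIV id
    {(k, l, m) :: int3 | k l m. 0 \<le> k + l - m \<and> k + l - m \<le> l - k \<and> l - k \<le> m}"
    (is "complete_representatives G UNIV id ?R")
  unfolding complete_representatives_def
proof (intro conjI ballI)
  show "?R \<subseteq> UNIV"
    by simp
next
  fix X
  assume "X \<in> orbits G UNIV id"
  then obtain x where X: "X = orbit G id x"
    by (auto simp: orbits_def)
  show "\<exists>!y. y \<in> ?R \<inter> X"
  proof (rule ex_ex1I)
    show "\<exists>y. y \<in> ?R \<inter> X"
      unfolding X by (rule orbit_G_meets[of x]) blast
  next
    fix y z
    assume y: "y \<in> ?R \<inter> X" and z: "z \<in> ?R \<inter> X"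
    obtain k l m where y': "y = (k, l, m)"
      by (cases y)
    obtain k' l' m' where z': "z = (k', l', m')"
      by (cases z)
    have "abs_pqm y = abs_pqm z"
      using y z abs_pqm_orbit[of y x] abs_pqm_orbit[of z x] unfolding X by simp
    then have eq: "{#\<bar>k + l - m\<bar>, \<bar>l - k\<bar>, \<bar>m\<bar>#} = {#\<bar>k' + l' - m'\<bar>, \<bar>l' - k'\<bar>, \<bar>m'\<bar>#}"
      by (simp add: abs_pqm_def y' z')
    have "k + l - m = k' + l' - m'" "l - k = l' - k'" "m = m'"
      using sorted_abs_triple_eq[OF eq] y z unfolding y' z' by auto
    then show "y = z"
      unfolding y' z' by simp
  qed
qed

end
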